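(* Let $X$, $Y$, $W$ be finite-dimensional real inner product spaces, $f:X\to\mathbb{R}$ and $g:Y\to\mathbb{R}$ convex functions, $\mathcal{A}:X\to W$ and $\mathcal{B}:Y\to W$ linear maps, and $\mathbf{c}\in W$. Consider the problem $$\min_{\mathbf{x}\in X,\ \mathbf{y}\in Y} f(\mathbf{x})+g(\mathbf{y})\quad\text{s.t.}\quad \mathcal{A}(\mathbf{x})+\mathcal{B}(\mathbf{y})=\mathbf{c},$$ and assume that it has at least one KKT point. Let $\{\beta_k\}_{k\ge 0}$ be a sequence of positive penalty parameters that is non-decreasing and upper bounded, and let $\eta_A>\|\mathcal{A}\|^2$ and $\eta_B>\|\mathcal{B}\|^2$. Then, for any starting point $(\mathbf{x}_0,\mathbf{y}_0,\lambda_0)\in X\times Y\times W$, the infinite sequence $\{(\mathbf{x}_k,\mathbf{y}_k,\lambda_k)\}_{k\ge 0}$ generated by the LADMAP iterations with penalties $\beta_k$ and parameters $\eta_A,\eta_B$ converges to a KKT point of the problem.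
   Context: $\|\cdot\|$ on $X,Y,W$ is the norm induced by the inner product (Euclidean norm for vectors, Frobenius norm for matrices). $\|\mathcal{A}\|,\|\mathcal{B}\|$ are the operator norms, and $\mathcal{A}^*,\mathcal{B}^*$ the adjoints. $\partial f,\partial g$ denote the convex subdifferentials. KKT point: a triple $(\mathbf{x}^*,\mathbf{y}^*,\lambda^* )\in X\times Y\times W$ with $\mathcal{A}(\mathbf{x}^* )+\mathcal{B}(\mathbf{y}^* )-\mathbf{c}=\mathbf{0}$, $-\mathcal{A}^*(\lambda^* )\in\partial f(\mathbf{x}^* )$ and $-\mathcal{B}^*(\lambda^* )\in\partial g(\mathbf{y}^* )$. LADMAP (linearized alternating direction method with adaptive penalty) iterations: given $(\mathbf{x}_k,\mathbf{y}_k,\lambda_k)$ and $\beta_k>0$, $$\mathbf{x}_{k+1}=\arg\min_{\mathbf{x}} f(\mathbf{x})+\frac{\beta_k\eta_A}{2}\left\|\mathbf{x}-\mathbf{x}_k+\frac{\mathcal{A}^*\big(\lambda_k+\beta_k(\mathcal{A}(\mathbf{x}_k)+\mathcal{B}(\mathbf{y}_k)-\mathbf{c})\big)}{\beta_k\eta_A}\right\|^2,$$ $$\mathbf{y}_{k+1}=\arg\min_{\mathbf{y}} g(\mathbf{y})+\frac{\beta_k\eta_B}{2}\left\|\mathbf{y}-\mathbf{y}_k+\frac{\mathcal{B}^*\big(\lambda_k+\beta_k(\mathcal{A}(\mathbf{x}_{k+1})+\mathcal{B}(\mathbf{y}_k)-\mathbf{c})\big)}{\beta_k\eta_B}\right\|^2,$$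 $$\lambda_{k+1}=\lambda_k+\beta_k\big[\mathcal{A}(\mathbf{x}_{k+1})+\mathcal{B}(\mathbf{y}_{k+1})-\mathbf{c}\big].$$ The iterations are run indefinitely (no stopping test). The penalties $\beta_k$ may be chosen adaptively, i.e. may depend on the iterates. The paper's specific rule is $\beta_{k+1}=\min(\beta_{\max},\rho\beta_k)$, where $\rho=\rho_0$ (a constant $\rho_0\ge 1$) if $\beta_k\max(\sqrt{\eta_A}\|\mathbf{x}_{k+1}-\mathbf{x}_k\|,\sqrt{\eta_B}\|\mathbf{y}_{k+1}-\mathbf{y}_k\|)/\|\mathbf{c}\|<\varepsilon_2$ and $\rho=1$ otherwise. With $\beta_0\le\beta_{\max}$ it produces a non-decreasing upper bounded sequence. The result depends on the penalties only through the stated hypotheses on $\{\beta_k\}$. *)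

theory Defs
  imports "HOL-Analysis.Analysis"
begin

definition subdifferential :: "('a::real_inner \<Rightarrow> real) \<Rightarrow> 'a \<Rightarrow> 'a set" where
  "subdifferential f x = {p. \<forall>z. f z \<ge> f x + p \<bullet> (z - x)}"

definition kkt_point ::
  "('x::real_inner \<Rightarrow> real) \<Rightarrow> ('y::real_inner \<Rightarrow> real) \<Rightarrow> ('x \<Rightarrow> 'w::real_inner) \<Rightarrow> ('y \<Rightarrow> 'w) \<Rightarrow> 'w
    \<Rightarrow> 'x \<times> 'y \<times> 'w \<Rightarrow> bool" where
  "kkt_point f g A B c = (\<lambda>(x, y, l).
     A x + B y - c = 0 \<and>
     - adjoint A l \<in> subdifferential f x \<and>
     - adjoint B l \<in> subdifferential g y)"

text \<open>
  In the next definition the objectives are finite convex functions plus a positive multiple of a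
  squared distance. On a finite-dimensional space each has exactly one minimizer, so the choice
  operator behind \<^const>\<open>arg_min\<close> plays no role.
\<close>

definition ladmap_sequence ::
  "('x::real_inner \<Rightarrow> real) \<Rightarrow> ('y::real_inner \<Rightarrow> real) \<Rightarrow> ('x \<Rightarrow> 'w::real_inner) \<Rightarrow> ('y \<Rightarrow> 'w) \<Rightarrow> 'w
    \<Rightarrow> real \<Rightarrow> real \<Rightarrow> (nat \<Rightarrow> real) \<Rightarrow> (nat \<Rightarrow> 'x) \<Rightarrow> (nat \<Rightarrow> 'y) \<Rightarrow> (nat \<Rightarrow> 'w) \<Rightarrow> bool" where
  "ladmap_sequence f g A B c \<eta>A \<eta>B \<beta> x y l \<longleftrightarrow> (\<forall>k.
     x (Suc k) = arg_min (\<lambda>u. f u + \<beta> k * \<eta>A / 2 *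
       (norm (u - x k + adjoint A (l k + \<beta> k *\<^sub>R (A (x k) + B (y k) - c)) /\<^sub>R (\<beta> k * \<eta>A)))\<^sup>2)
       (\<lambda>_. True) \<and>
     y (Suc k) = arg_min (\<lambda>v. g v + \<beta> k * \<eta>B / 2 *
       (norm (v - y k + adjoint B (l k + \<beta> k *\<^sub>R (A (x (Suc k)) + B (y k) - c)) /\<^sub>R (\<beta> k * \<eta>B)))\<^sup>2)
       (\<lambda>_. True) \<and>
     l (Suc k) = l k + \<beta> k *\<^sub>R (A (x (Suc k)) + B (y (Suc k)) - c))"

end

theory Submission
  imports Defs "HOL-Real_Asymp.Real_Asymp"
begin

text \<open>
  For a KKT point (x', y', l') the energy
  E k = \<eta>A |x k - x'|^2 - |A (x k - x')|^2 + \<eta>B |y k - y'|^2 + |l k - l'|^2 / (\<beta> k)^2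
  is nonnegative and decreases by at least a positive definite quadratic form in the increments:
  add the monotonicity inequalities of the two subdifferentials, and use that a larger \<beta> only
  shrinks the last term. Hence the iterates are bounded and the increments and the
  constraint residual tend to zero, so every cluster point is itself a KKT point. The energy
  relative to a cluster point is decreasing and tends to zero along a subsequence, hence tends to
  zero, and with it the distance to the cluster point, because \<beta> is bounded.
\<close>

section \<open>Finite-dimensional inner product spaces\<close>

text \<open>Finite dimension is given by a finite spanning set, so coordinates come from an
  orthogonal spanning set \<open>C\<close>, normalised by \<open>sgn\<close>. The defect of the
  expansion is orthogonal to all of \<open>C\<close>, hence to the whole space and to itself. A zero
  vector in \<open>C\<close> is harmless because \<open>sgn 0 = 0\<close>.\<close>

lemma finite_span_expansion:
  fixes S :: "'a::real_inner set"
  assumes "finite S" "span S = UNIV"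
  obtains C :: "'a set" where "finite C" "\<And>x. x = (\<Sum>b\<in>C. (x \<bullet> sgn b) *\<^sub>R sgn b)"
proof -
  obtain C :: "'a set" where C: "finite C" "span C = UNIV" "pairwise orthogonal C"
    using basis_orthogonal[OF assms(1)] unfolding assms(2) by blast
  have "x = (\<Sum>b\<in>C. (x \<bullet> sgn b) *\<^sub>R sgn b)" for x
  proof -
    define e where "e = x - (\<Sum>b\<in>C. (x \<bullet> sgn b) *\<^sub>R sgn b)"
    have "orthogonal e d" if "d \<in> C" for d
    proof -
      have "(\<Sum>b\<in>C. (x \<bullet> sgn b) *\<^sub>R sgn b) \<bullet> d = (\<Sum>b\<in>C. (x \<bullet> sgn b) * (sgn b \<bullet> d))"
        by (simp add: inner_sum_left)
      also have "\<dots> = (\<Sum>b\<in>C. if b = d then x \<bullet> d else 0)"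
      proof (rule sum.cong[OF refl])
        fix b assume "b \<in> C"
        show "(x \<bullet> sgn b) * (sgn b \<bullet> d) = (if b = d then x \<bullet> d else 0)"
        proof (cases "b = d")
          case True
          then show ?thesis
            by (cases "d = 0") (auto simp: sgn_div_norm divide_simps norm_eq_sqrt_inner)
        next
          case False
          then have "b \<bullet> d = 0"
            using C(3) \<open>b \<in> C\<close> that by (auto simp: pairwise_def orthogonal_def)
          then show ?thesis using False by (simp add: sgn_div_norm)
        qed
      qed
      also have "\<dots> = x \<bullet> d" using C(1) that by simp
      finally show ?thesis by (simp add: orthogonal_def e_def inner_diff_left)
    qed
    then have "orthogonal e e" using orthogonal_to_span[of e C e] C(2) by auto
    then show ?thesis by (simp add: e_def orthogonal_self)
  qed
  then show thesis using that C(1) by blast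
qed

text \<open>Each new generator adds a compact segment in the Minkowski sense, and a sum of two
  compact sets is compact.\<close>

lemma compact_cube_combinations:
  fixes e :: "'b \<Rightarrow> 'a::real_normed_vector"
  assumes "finite C"
  shows "compact {(\<Sum>b\<in>C. u b *\<^sub>R e b) |u. \<forall>b\<in>C. \<bar>u b\<bar> \<le> (r::real)}"
  using assms
proof (induction C rule: finite_induct)
  case empty
  then show ?case by simp
next
  case (insert d C)
  let ?K = "\<lambda>C. {(\<Sum>b\<in>C. u b *\<^sub>R e b) |u. \<forall>b\<in>C. \<bar>u b\<bar> \<le> r}"
  have "?K (insert d C) = {s + t |s t. s \<in> (\<lambda>a. a *\<^sub>R e d) ` {-r..r} \<and> t \<in> ?K C}" (is "?L = ?R")
  proof (intro equalityI subsetI)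
    fix z assume "z \<in> ?L"
    then obtain u where u: "z = (\<Sum>b\<in>insert d C. u b *\<^sub>R e b)" "\<forall>b\<in>insert d C. \<bar>u b\<bar> \<le> r"
      by blast
    from u(1) have "z = u d *\<^sub>R e d + (\<Sum>b\<in>C. u b *\<^sub>R e b)" using insert.hyps by simp
    moreover have "u d \<in> {-r..r}" "\<forall>b\<in>C. \<bar>u b\<bar> \<le> r" using u(2) by (auto simp: abs_le_iff)
    ultimately show "z \<in> ?R" by blast
  next
    fix z assume "z \<in> ?R"
    then obtain a u where u: "z = a *\<^sub>R e d + (\<Sum>b\<in>C. u b *\<^sub>R e b)" "a \<in> {-r..r}" "\<forall>b\<in>C. \<bar>u b\<bar> \<le> r"
      by blast
    have "z = (\<Sum>b\<in>insert d C. (u(d := a)) b *\<^sub>R e b)"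
      using insert.hyps u(1) by (auto intro!: sum.cong)
    moreover have "\<forall>b\<in>insert d C. \<bar>(u(d := a)) b\<bar> \<le> r" using u by auto
    ultimately show "z \<in> ?L" by blast
  qed
  moreover have "compact ((\<lambda>a. a *\<^sub>R e d) ` {-r..r})"
    by (intro compact_continuous_image continuous_intros) auto
  then have "compact {s + t |s t. s \<in> (\<lambda>a. a *\<^sub>R e d) ` {-r..r} \<and> t \<in> ?K C}"
    using insert.IH by (rule compact_sums)
  ultimately show ?case by (simp only:)
qed

text \<open>Every coordinate is an inner product with a vector of norm at most 1, so Cauchy-Schwarz
  bounds it by the norm.\<close>

lemma cball_subset_cube_combinations:
  fixes C :: "'a::real_inner set"
  assumes "\<And>x. x = (\<Sum>b\<in>C. (x \<bullet> sgn b) *\<^sub>R sgn b)"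
  shows "cball 0 r \<subseteq> {(\<Sum>b\<in>C. u b *\<^sub>R sgn b) |u. \<forall>b\<in>C. \<bar>u b\<bar> \<le> r}"
proof
  fix x :: 'a assume "x \<in> cball 0 r"
  then have "norm x \<le> r" by simp
  moreover from this have "0 \<le> r" using norm_ge_zero order_trans by blast
  ultimately have "\<bar>x \<bullet> sgn b\<bar> \<le> r" for b
    using Cauchy_Schwarz_ineq2[of x "sgn b"]
    by (cases "b = 0") (auto simp: norm_sgn)
  then show "x \<in> {(\<Sum>b\<in>C. u b *\<^sub>R sgn b) |u. \<forall>b\<in>C. \<bar>u b\<bar> \<le> r}"
    by (intro CollectI exI[of _ "\<lambda>b. x \<bullet> sgn b"] conjI assms) auto
qed

lemma compact_cball_finite_span:
  fixes S :: "'a::real_inner set"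
  assumes "finite S" "span S = UNIV"
  shows "compact (cball (0::'a) r)"
proof -
  obtain C :: "'a set" where C: "finite C" "\<And>x. x = (\<Sum>b\<in>C. (x \<bullet> sgn b) *\<^sub>R sgn b)"
    using finite_span_expansion[OF assms] by blast
  show ?thesis
    using compact_Int_closed[OF compact_cube_combinations[OF C(1), of sgn r] closed_cball[of 0 r]]
      cball_subset_cube_combinations[OF C(2), of r]
    by (simp add: Int_absorb1)
qed

lemma linear_finite_span_expansion:
  fixes F :: "'a::real_inner \<Rightarrow> 'b::real_vector"
  assumes "linear F" "\<And>x. x = (\<Sum>b\<in>C. (x \<bullet> sgn b) *\<^sub>R sgn b)"
  shows "F x = (\<Sum>b\<in>C. (x \<bullet> sgn b) *\<^sub>R F (sgn b))"
proof -
  have "F x = F (\<Sum>b\<in>C. (x \<bullet> sgn b) *\<^sub>R sgn b)" by (rule arg_cong[OF assms(2)])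
  then show ?thesis by (simp only: linear_sum[OF assms(1)] linear_scale[OF assms(1)])
qed

lemma bounded_linear_finite_span:
  fixes F :: "'a::real_inner \<Rightarrow> 'b::real_normed_vector"
  assumes "finite S" "span S = (UNIV :: 'a set)" "linear F"
  shows "bounded_linear F"
proof -
  obtain C :: "'a set" where C: "finite C" "\<And>x. x = (\<Sum>b\<in>C. (x \<bullet> sgn b) *\<^sub>R sgn b)"
    using finite_span_expansion[OF assms(1,2)] by blast
  have "bounded_linear (\<lambda>x. \<Sum>b\<in>C. (x \<bullet> sgn b) *\<^sub>R F (sgn b))"
    by (intro bounded_linear_sum bounded_linear_scaleR_const bounded_linear_inner_left)
  moreover have "F = (\<lambda>x. \<Sum>b\<in>C. (x \<bullet> sgn b) *\<^sub>R F (sgn b))"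
    by (rule ext, rule linear_finite_span_expansion[OF assms(3) C(2)])
  ultimately show ?thesis by metis
qed

text \<open>\<open>adjoint\<close> is defined by choice, so its characteristic identity needs a
  witness. The map \<open>G\<close> supplies one, with the numbers
  \<open>F (sgn b) \<bullet> w\<close> as coordinates.\<close>

lemma adjoint_works_finite_span:
  fixes F :: "'a::real_inner \<Rightarrow> 'b::real_inner"
  assumes "finite S" "span S = (UNIV :: 'a set)" "linear F"
  shows "F x \<bullet> w = x \<bullet> adjoint F w"
proof -
  obtain C :: "'a set" where C: "finite C" "\<And>x. x = (\<Sum>b\<in>C. (x \<bullet> sgn b) *\<^sub>R sgn b)"
    using finite_span_expansion[OF assms(1,2)] by blast
  define G where "G = (\<lambda>w. \<Sum>b\<in>C. (F (sgn b) \<bullet> w) *\<^sub>R sgn b)"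
  have G: "\<forall>x w. F x \<bullet> w = x \<bullet> G w"
  proof (intro allI)
    fix x w
    have "F x \<bullet> w = (\<Sum>b\<in>C. (x \<bullet> sgn b) *\<^sub>R F (sgn b)) \<bullet> w"
      by (rule arg_cong[OF linear_finite_span_expansion[OF assms(3) C(2)]])
    also have "\<dots> = x \<bullet> G w"
      by (simp add: G_def inner_sum_left inner_sum_right mult.commute)
    finally show "F x \<bullet> w = x \<bullet> G w" .
  qed
  then have "adjoint F = G" by (rule adjoint_unique)
  then show ?thesis using G by simp
qed

section \<open>Convex functions and proximal steps\<close>

text \<open>A point of the cube is the midpoint of a point on the line through \<open>e d\<close>
  and a combination of the other vectors, both with doubled coefficients. The doubling is why
  \<open>r\<close> varies in the induction. On the segment along \<open>e d\<close>, the values at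
  the two ends bound \<open>f\<close>.\<close>

lemma convex_on_cube_combinations_bounded_above:
  fixes f :: "'a::real_vector \<Rightarrow> real"
  assumes "finite C" "convex_on UNIV f" "r > 0"
  shows "\<exists>M. \<forall>u. (\<forall>b\<in>C. \<bar>u b\<bar> \<le> r) \<longrightarrow> f (\<Sum>b\<in>C. u b *\<^sub>R e b) \<le> M"
  using assms(1,3)
proof (induction C arbitrary: r rule: finite_induct)
  case empty
  then show ?case by auto
next
  case (insert d C)
  obtain M where M: "\<forall>u. (\<forall>b\<in>C. \<bar>u b\<bar> \<le> 2 * r) \<longrightarrow> f (\<Sum>b\<in>C. u b *\<^sub>R e b) \<le> M"
    using insert.IH[of "2 * r"] insert.prems by auto
  let ?N = "\<bar>f ((- 2 * r) *\<^sub>R e d)\<bar> + \<bar>f ((2 * r) *\<^sub>R e d)\<bar>"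
  have N: "f ((2 * a) *\<^sub>R e d) \<le> ?N" if "\<bar>a\<bar> \<le> r" for a
  proof -
    \<comment> \<open>\<open>t\<close> is the relative position of \<open>2 * a\<close> between
      \<open>- 2 * r\<close> and \<open>2 * r\<close>.\<close>
    define t where "t = (a + r) / (2 * r)"
    have t: "0 \<le> t" "t \<le> 1" using that insert.prems by (auto simp: t_def field_simps)
    have "(1 - t) * (- 2 * r) + t * (2 * r) = 2 * a"
      using insert.prems by (simp add: t_def field_simps)
    then have "(2 * a) *\<^sub>R e d = (1 - t) *\<^sub>R ((- 2 * r) *\<^sub>R e d) + t *\<^sub>R ((2 * r) *\<^sub>R e d)"
      by (metis scaleR_left.add scaleR_scaleR)
    then have "f ((2 * a) *\<^sub>R e d) \<le> (1 - t) * f ((- 2 * r) *\<^sub>R e d) + t * f ((2 * r) *\<^sub>R e d)"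
      by (simp only: convex_onD[OF assms(2) t UNIV_I UNIV_I])
    also have "\<dots> \<le> \<bar>(1 - t) * f ((- 2 * r) *\<^sub>R e d)\<bar> + \<bar>t * f ((2 * r) *\<^sub>R e d)\<bar>"
      by (intro add_mono abs_ge_self)
    also have "\<dots> \<le> 1 * \<bar>f ((- 2 * r) *\<^sub>R e d)\<bar> + 1 * \<bar>f ((2 * r) *\<^sub>R e d)\<bar>"
      unfolding abs_mult using t by (intro add_mono mult_right_mono) auto
    finally show ?thesis by simp
  qed
  have "f (\<Sum>b\<in>insert d C. u b *\<^sub>R e b) \<le> (?N + M) / 2" if u: "\<forall>b\<in>insert d C. \<bar>u b\<bar> \<le> r" for u
  proof -
    have "(\<Sum>b\<in>insert d C. u b *\<^sub>R e b)
        = (1 - 1/2) *\<^sub>R ((2 * u d) *\<^sub>R e d) + (1/2) *\<^sub>R (\<Sum>b\<in>C. (2 * u b) *\<^sub>R e b)"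
      using insert.hyps by (simp add: scaleR_sum_right)
    then have "f (\<Sum>b\<in>insert d C. u b *\<^sub>R e b)
        \<le> (1 - 1/2) * f ((2 * u d) *\<^sub>R e d) + (1/2) * f (\<Sum>b\<in>C. (2 * u b) *\<^sub>R e b)"
      using convex_onD[OF assms(2), of "1/2" "(2 * u d) *\<^sub>R e d" "\<Sum>b\<in>C. (2 * u b) *\<^sub>R e b"]
      by simp
    moreover have "f (\<Sum>b\<in>C. (2 * u b) *\<^sub>R e b) \<le> M"
      using u by (intro M[rule_format]) (auto simp: abs_mult)
    ultimately show ?thesis using N[of "u d"] u by simp
  qed
  then show ?case by blast
qed

text \<open>An upper bound on a cube is one on a ball. Reflection in the centre turns it into a
  bound on the absolute value, and a convex function bounded on an open ball is continuous
  there.\<close>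

lemma convex_on_UNIV_continuous_finite_span:
  fixes f :: "'a::real_inner \<Rightarrow> real"
  assumes "finite S" "span S = (UNIV :: 'a set)" "convex_on UNIV f"
  shows "continuous_on UNIV f"
proof -
  obtain C :: "'a set" where C: "finite C" "\<And>x. x = (\<Sum>b\<in>C. (x \<bullet> sgn b) *\<^sub>R sgn b)"
    using finite_span_expansion[OF assms(1,2)] by blast
  have "isCont f x" for x
  proof -
    \<comment> \<open>The ball is centred at the origin, as the cubes are; the extra 1 puts
      \<open>x\<close> in its interior.\<close>
    define r where "r = norm x + 1"
    have r: "r > 0" by (simp add: r_def add_nonneg_pos)
    obtain M where M: "\<forall>u. (\<forall>b\<in>C. \<bar>u b\<bar> \<le> r) \<longrightarrow> f (\<Sum>b\<in>C. u b *\<^sub>R sgn b) \<le> M"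
      using convex_on_cube_combinations_bounded_above[OF C(1) assms(3) r] by blast
    have "f z \<le> M" if "z \<in> cball 0 r" for z
      using cball_subset_cube_combinations[OF C(2), of r] that M by blast
    then have "\<forall>z\<in>ball 0 r. \<bar>f z\<bar> \<le> M + 2 * \<bar>f 0\<bar>"
      using convex_bounds_lemma[of 0 r f M] convex_on_subset[OF assms(3)] by auto
    then have "continuous_on (ball 0 r) f"
      using convex_on_bounded_continuous[of "ball 0 r" f] convex_on_subset[OF assms(3)] by auto
    moreover have "x \<in> ball 0 r" by (simp add: r_def)
    ultimately show ?thesis by (simp add: continuous_on_eq_continuous_at)
  qed
  then show ?thesis by (simp add: continuous_at_imp_continuous_on)
qed

text \<open>Convexity along rays bounds f from below by an affine function of the norm, so the
  quadratic term makes the objective coercive.\<close>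

lemma proximal_minimizer_exists:
  fixes f :: "'a::real_inner \<Rightarrow> real"
  assumes S: "finite S" "span S = (UNIV :: 'a set)" and f: "convex_on UNIV f" and "r > 0"
  shows "\<exists>u. \<forall>z. f u + r / 2 * (norm (u - a))\<^sup>2 \<le> f z + r / 2 * (norm (z - a))\<^sup>2"
proof -
  let ?h = "\<lambda>u. f u + r / 2 * (norm (u - a))\<^sup>2"
  have cf: "continuous_on T f" for T
    using convex_on_UNIV_continuous_finite_span[OF S f] continuous_on_subset by blast
  have "\<exists>m. \<forall>z\<in>cball 0 1. m \<le> f z"
    using continuous_attains_inf[OF compact_cball_finite_span[OF S] _ cf, of 1] by auto
  then obtain m where "\<forall>z\<in>cball 0 1. m \<le> f z" ..
  then have m: "m \<le> f z" if "norm z \<le> 1" for z using that by simp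
  define K where "K = \<bar>m\<bar> + \<bar>f 0\<bar>"
  have affine: "f z \<ge> - K * norm z - K" for z
  proof (cases "norm z \<le> 1")
    case True
    then have "m \<le> f z" by (rule m)
    moreover have "0 \<le> K * norm z" by (simp add: K_def)
    moreover have "- K \<le> m" by (simp add: K_def)
    ultimately show ?thesis by simp
  next
    case False
    \<comment> \<open>\<open>t *\<^sub>R z\<close> lies on the unit sphere, where \<open>m\<close>
      is a lower bound; convexity on the segment from 0 to \<open>z\<close> carries this bound out
      to \<open>z\<close>.\<close>
    define t where "t = 1 / norm z"
    have t: "0 \<le> t" "t \<le> 1" "t * norm z = 1" using False by (auto simp: t_def divide_simps)
    have "m \<le> f (t *\<^sub>R z)" using t by (intro m) auto
    also have "\<dots> \<le> (1 - t) * f 0 + t * f z" using convex_onD[OF f t(1,2), of 0 z] by simp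
    finally have "m * norm z \<le> ((1 - t) * f 0 + t * f z) * norm z" by (intro mult_right_mono) auto
    also have "\<dots> = norm z * f 0 - (t * norm z) * f 0 + (t * norm z) * f z" by (simp add: algebra_simps)
    finally have "f z \<ge> m * norm z - norm z * f 0 + f 0" using t(3) by simp
    moreover have "(m - f 0) * norm z \<ge> - K * norm z" by (intro mult_right_mono) (auto simp: K_def)
    moreover have "f 0 \<ge> - K" by (auto simp: K_def)
    ultimately show ?thesis by (simp add: algebra_simps)
  qed
  have "\<forall>\<^sub>F t in at_top. - K * t - K + r / 2 * (t - norm a)\<^sup>2 \<ge> ?h 0"
    using \<open>r > 0\<close> by real_asymp
  then obtain R where R: "\<And>t. t \<ge> R \<Longrightarrow> - K * t - K + r / 2 * (t - norm a)\<^sup>2 \<ge> ?h 0"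
    by (auto simp: eventually_at_top_linorder)
  have far: "?h 0 \<le> ?h z" if "norm z \<ge> R" for z
  proof -
    have "\<bar>norm z - norm a\<bar> \<le> \<bar>norm (z - a)\<bar>" using norm_triangle_ineq3[of z a] by simp
    then have "r / 2 * (norm z - norm a)\<^sup>2 \<le> r / 2 * (norm (z - a))\<^sup>2"
      using \<open>r > 0\<close> by (intro mult_left_mono iffD1[OF abs_le_square_iff]) auto
    then show ?thesis using R[OF that] affine[of z] by linarith
  qed
  \<comment> \<open>The radius is taken nonnegative so that the ball contains 0. A minimum over the
    ball is then at most \<open>?h 0\<close>, and hence at most every value outside.\<close>
  have "continuous_on (cball 0 \<bar>R\<bar>) ?h" by (intro continuous_intros cf)
  then have "\<exists>u\<in>cball 0 \<bar>R\<bar>. \<forall>z\<in>cball 0 \<bar>R\<bar>. ?h u \<le> ?h z"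
    using continuous_attains_inf[OF compact_cball_finite_span[OF S], of "\<bar>R\<bar>" ?h] by auto
  then obtain u where "\<forall>z\<in>cball 0 \<bar>R\<bar>. ?h u \<le> ?h z" ..
  then have u: "?h u \<le> ?h z" if "norm z \<le> \<bar>R\<bar>" for z using that by simp
  have "?h u \<le> ?h z" for z
  proof (cases "norm z \<le> \<bar>R\<bar>")
    case True
    then show ?thesis by (rule u)
  next
    case False
    then show ?thesis using u[of 0] order_trans[OF _ far[of z]] by simp
  qed
  then show ?thesis by blast
qed

text \<open>Compare \<open>u\<close> with the points of the segment from \<open>u\<close> to
  \<open>z\<close>. The first-order terms carry a factor \<open>t\<close>, the quadratic remainder a
  factor \<open>t * t\<close>; dividing by \<open>t\<close> and letting it fall to 0 leaves the
  subgradient inequality.\<close>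

lemma proximal_subgradient:
  fixes f :: "'a::real_inner \<Rightarrow> real"
  assumes f: "convex_on UNIV f" and "r > 0"
    and min: "\<And>z. f u + r / 2 * (norm (u - a))\<^sup>2 \<le> f z + r / 2 * (norm (z - a))\<^sup>2"
  shows "r *\<^sub>R (a - u) \<in> subdifferential f u"
proof -
  have "f u + r *\<^sub>R (a - u) \<bullet> (z - u) \<le> f z" for z
  proof -
    let ?D = "r / 2 * (norm (z - u))\<^sup>2"
    have ineq: "f u + r *\<^sub>R (a - u) \<bullet> (z - u) \<le> f z + t * ?D" if t: "0 < t" "t \<le> 1" for t
    proof -
      define w where "w = (1 - t) *\<^sub>R u + t *\<^sub>R z"
      have "w - a = (u - a) + t *\<^sub>R (z - u)" by (simp add: w_def algebra_simps)
      then have w: "(norm (w - a))\<^sup>2 = (norm (u - a))\<^sup>2 + 2 * t * ((u - a) \<bullet> (z - u)) + t\<^sup>2 * (norm (z - u))\<^sup>2"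
        unfolding power2_norm_eq_inner
        by (simp only: inner_add_left inner_add_right inner_scaleR_left inner_scaleR_right
            inner_commute[of "z - u" "u - a"] power2_eq_square) (simp add: algebra_simps)
      have "f u + r / 2 * (norm (u - a))\<^sup>2 \<le> ((1 - t) * f u + t * f z) + r / 2 * (norm (w - a))\<^sup>2"
        using min[of w] convex_onD[OF f, of t u z] t by (simp add: w_def)
      then have "0 \<le> t * (f z + t * ?D - f u + r * ((u - a) \<bullet> (z - u)))"
        unfolding w by (simp add: algebra_simps power2_eq_square)
      moreover have "r * ((u - a) \<bullet> (z - u)) = - (r *\<^sub>R (a - u) \<bullet> (z - u))"
        by (simp add: inner_diff_left algebra_simps)
      ultimately have "0 \<le> t * (f z + t * ?D - f u - r *\<^sub>R (a - u) \<bullet> (z - u))" by simp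
      then show ?thesis using t by (simp add: zero_le_mult_iff)
    qed
    have "((\<lambda>t. f z + t * ?D) \<longlongrightarrow> f z + 0 * ?D) (at_right 0)" by (intro tendsto_intros)
    moreover have "\<forall>\<^sub>F t in at_right (0::real). f u + r *\<^sub>R (a - u) \<bullet> (z - u) \<le> f z + t * ?D"
      unfolding eventually_at_right_field using ineq by (intro exI[of _ 1]) auto
    ultimately show ?thesis by (auto dest: tendsto_lowerbound)
  qed
  then show ?thesis by (simp add: subdifferential_def)
qed

text \<open>This turns each minimization step into an inclusion. The square is centred at
  \<open>a - d /\<^sub>R r\<close>, and the existence of a minimizer ensures that the point chosen
  by \<open>arg_min\<close> is one.\<close>

lemma arg_min_proximal_subgradient:
  fixes f :: "'a::real_inner \<Rightarrow> real"
  assumes S: "finite S" "span S = (UNIV :: 'a set)" and f: "convex_on UNIV f" and "r > 0"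
    and u: "u = arg_min (\<lambda>u. f u + r / 2 * (norm (u - a + d /\<^sub>R r))\<^sup>2) (\<lambda>_. True)"
  shows "- r *\<^sub>R (u - a) - d \<in> subdifferential f u"
proof -
  let ?h = "\<lambda>u. f u + r / 2 * (norm (u - (a - d /\<^sub>R r)))\<^sup>2"
  have "u = arg_min ?h (\<lambda>_. True)" using u by (simp add: algebra_simps)
  moreover obtain u0 where u0: "\<forall>z. ?h u0 \<le> ?h z"
    using proximal_minimizer_exists[OF S f \<open>r > 0\<close>, of "a - d /\<^sub>R r"] ..
  have "?h (arg_min ?h (\<lambda>_. True)) \<le> ?h z" for z
    by (rule arg_minI[of "\<lambda>_. True" u0 ?h]) (simp_all only: not_less u0 simp_thms)
  ultimately have "?h u \<le> ?h z" for z by (simp only:)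
  then have "r *\<^sub>R ((a - d /\<^sub>R r) - u) \<in> subdifferential f u"
    by (rule proximal_subgradient[OF f \<open>r > 0\<close>])
  moreover have "r *\<^sub>R ((a - d /\<^sub>R r) - u) = - r *\<^sub>R (u - a) - d"
    using \<open>r > 0\<close> by (simp add: algebra_simps)
  ultimately show ?thesis by simp
qed

lemma subdifferential_monotone:
  assumes "p \<in> subdifferential f x" "q \<in> subdifferential f z"
  shows "(p - q) \<bullet> (x - z) \<ge> 0"
proof -
  have "f z \<ge> f x + p \<bullet> (z - x)" "f x \<ge> f z + q \<bullet> (x - z)"
    using assms by (auto simp: subdifferential_def)
  then show ?thesis by (simp add: inner_diff_left inner_diff_right)
qed

text \<open>The subgradients enter only through their pairings with \<open>z - x n\<close>. In the
  application the adjoint is moved to the other side of the pairing, where continuity of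
  \<open>A\<close> and \<open>B\<close> gives the limit.\<close>

lemma subdifferential_closed_limit:
  fixes f :: "'a::real_inner \<Rightarrow> real"
  assumes f: "continuous_on UNIV f" and "x \<longlonglongrightarrow> x0"
    and sub: "\<And>n. p n \<in> subdifferential f (x n)"
    and lim: "\<And>z. (\<lambda>n. p n \<bullet> (z - x n)) \<longlonglongrightarrow> q \<bullet> (z - x0)"
  shows "q \<in> subdifferential f x0"
proof -
  have "(\<lambda>n. f (x n)) \<longlonglongrightarrow> f x0"
    using continuous_on_tendsto_compose[OF f assms(2)] by simp
  then have "(\<lambda>n. f (x n) + p n \<bullet> (z - x n)) \<longlonglongrightarrow> f x0 + q \<bullet> (z - x0)" for z
    using lim by (intro tendsto_add)
  moreover have "f (x n) + p n \<bullet> (z - x n) \<le> f z" for n z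
    using sub[of n] by (simp add: subdifferential_def)
  ultimately show ?thesis
    unfolding subdifferential_def mem_Collect_eq by (meson LIMSEQ_le_const2)
qed

section \<open>The descent inequality\<close>

text \<open>To be read with a = A u, b = B v and q the multiplier error divided by \<beta>. The cross term of
  q' - q and b' - b has no sign; completing the square costs the norm of b' - b, which \<eta>B pays for.\<close>

lemma ladmap_descent_algebra:
  fixes u u' :: "'x::real_inner" and v v' :: "'y::real_inner" and a a' b b' q q' :: "'w::real_inner"
  assumes q': "q' = q + (a' + b')"
    and x: "0 \<le> - \<eta>A * ((u' - u) \<bullet> u') - (q' - (a' - a) - (b' - b)) \<bullet> a'"
    and y: "0 \<le> - \<eta>B * ((v' - v) \<bullet> v') - (q' - (b' - b)) \<bullet> b'"
  shows "\<eta>A * (norm u')\<^sup>2 - (norm a')\<^sup>2 + \<eta>B * (norm v')\<^sup>2 + (norm q')\<^sup>2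
      + (\<eta>A * (norm (u' - u))\<^sup>2 - (norm (a' - a))\<^sup>2
        + (\<eta>B * (norm (v' - v))\<^sup>2 - (norm (b' - b))\<^sup>2) + (norm ((q' - q) - (b' - b)))\<^sup>2)
      \<le> \<eta>A * (norm u)\<^sup>2 - (norm a)\<^sup>2 + \<eta>B * (norm v)\<^sup>2 + (norm q)\<^sup>2"
    (is "?L \<le> ?R")
proof -
  \<comment> \<open>The two sides differ by exactly twice the two monotonicity terms. Once each
    inner product is written in one fixed order, this is a polynomial identity.\<close>
  have "?L = ?R - 2 * (- \<eta>A * ((u' - u) \<bullet> u') - (q' - (a' - a) - (b' - b)) \<bullet> a')
      - 2 * (- \<eta>B * ((v' - v) \<bullet> v') - (q' - (b' - b)) \<bullet> b')"
    unfolding q' power2_norm_eq_inner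
    by (simp only: inner_add_left inner_add_right inner_diff_left inner_diff_right
        inner_commute[of u' u] inner_commute[of v' v] inner_commute[of a' a] inner_commute[of b' b]
        inner_commute[of b' a'] inner_commute[of b a] inner_commute[of b' a] inner_commute[of b a']
        inner_commute[of q a] inner_commute[of q a'] inner_commute[of q b] inner_commute[of q b'])
      algebra
  moreover have "r \<le> s" if "r = s - 2 * h - 2 * k" "0 \<le> h" "0 \<le> k" for r s h k :: real
    using that by simp
  ultimately show ?thesis using x y by blast
qed

section \<open>Convergence of the iteration\<close>

lemma tendsto_zero_of_scaled_square_le:
  fixes h :: "nat \<Rightarrow> 'a::real_normed_vector"
  assumes "a > 0" "\<And>k. a * (norm (h k))\<^sup>2 \<le> e k" "e \<longlonglongrightarrow> 0"
  shows "h \<longlonglongrightarrow> 0"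
proof -
  have "(\<lambda>k. e k / a) \<longlonglongrightarrow> 0" using tendsto_divide[OF assms(3) tendsto_const, of a] assms(1) by simp
  moreover have le: "norm ((norm (h k))\<^sup>2) \<le> e k / a" for k
    using assms(1) assms(2)[of k] by (simp add: field_simps)
  ultimately have "(\<lambda>k. (norm (h k))\<^sup>2) \<longlonglongrightarrow> 0"
    by (intro Lim_null_comparison[OF always_eventually[OF allI[OF le]]])
  then have "(\<lambda>k. sqrt ((norm (h k))\<^sup>2)) \<longlonglongrightarrow> sqrt 0" by (rule tendsto_real_sqrt)
  then show ?thesis by (simp add: tendsto_norm_zero_iff)
qed

text \<open>The minimization steps appear here as their optimality inclusions. Finite dimension is
  present only through its consequences: bounded maps, true adjoints and continuous objectives.
  Compactness is added in the final theorem.\<close>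

locale ladmap =
  fixes f :: "'x::real_inner \<Rightarrow> real" and g :: "'y::real_inner \<Rightarrow> real"
    and A :: "'x \<Rightarrow> 'w::real_inner" and B :: "'y \<Rightarrow> 'w" and c :: 'w
    and \<eta>A \<eta>B :: real and \<beta> :: "nat \<Rightarrow> real"
    and x :: "nat \<Rightarrow> 'x" and y :: "nat \<Rightarrow> 'y" and l :: "nat \<Rightarrow> 'w"
  assumes A: "bounded_linear A" and B: "bounded_linear B"
    and adjoint_A: "A u \<bullet> w = u \<bullet> adjoint A w"
    and adjoint_B: "B v \<bullet> w = v \<bullet> adjoint B w"
    and cont_f: "continuous_on UNIV f" and cont_g: "continuous_on UNIV g"
    and \<beta>_pos: "\<beta> k > 0" and \<beta>_mono: "incseq \<beta>" and \<beta>_bdd: "bdd_above (range \<beta>)"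
    and \<eta>A: "\<eta>A > (onorm A)\<^sup>2" and \<eta>B: "\<eta>B > (onorm B)\<^sup>2"
    and x_step: "- (\<beta> k * \<eta>A) *\<^sub>R (x (Suc k) - x k)
      - adjoint A (l k + \<beta> k *\<^sub>R (A (x k) + B (y k) - c)) \<in> subdifferential f (x (Suc k))"
    and y_step: "- (\<beta> k * \<eta>B) *\<^sub>R (y (Suc k) - y k)
      - adjoint B (l k + \<beta> k *\<^sub>R (A (x (Suc k)) + B (y k) - c)) \<in> subdifferential g (y (Suc k))"
    and l_step: "l (Suc k) = l k + \<beta> k *\<^sub>R (A (x (Suc k)) + B (y (Suc k)) - c)"
begin

interpretation A: bounded_linear A by (rule A)
interpretation B: bounded_linear B by (rule B)

lemma inner_adjoint_A: "adjoint A w \<bullet> u = w \<bullet> A u"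
  using adjoint_A[of u w] by (simp add: inner_commute)

lemma inner_adjoint_B: "adjoint B w \<bullet> v = w \<bullet> B v"
  using adjoint_B[of v w] by (simp add: inner_commute)

lemma norm_A_le: "(norm (A u))\<^sup>2 \<le> (onorm A)\<^sup>2 * (norm u)\<^sup>2"
  using power_mono[OF onorm[OF A, of u], of 2] by (simp add: power_mult_distrib)

lemma norm_B_le: "(norm (B v))\<^sup>2 \<le> (onorm B)\<^sup>2 * (norm v)\<^sup>2"
  using power_mono[OF onorm[OF B, of v], of 2] by (simp add: power_mult_distrib)

lemma \<eta>B_pos: "\<eta>B > 0"
  using \<eta>B by (rule le_less_trans[OF zero_le_power2])

lemma \<beta>_convergent: obtains b where "\<beta> \<longlonglongrightarrow> b"
  using LIMSEQ_incseq_SUP[OF \<beta>_bdd \<beta>_mono] by blast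

section \<open>Energy and its descent\<close>

definition energy :: "'x \<times> 'y \<times> 'w \<Rightarrow> nat \<Rightarrow> real" where
  "energy = (\<lambda>(x', y', l') k. \<eta>A * (norm (x k - x'))\<^sup>2 - (norm (A (x k - x')))\<^sup>2
     + \<eta>B * (norm (y k - y'))\<^sup>2 + (norm ((l k - l') /\<^sub>R \<beta> k))\<^sup>2)"

text \<open>A lower bound for the quadratic form in the increments, with operator norms in place of
  \<open>A\<close> and \<open>B\<close> in the first two terms. It involves no KKT point. The last
  term serves to recover the constraint residual.\<close>

definition dissipation :: "nat \<Rightarrow> real" where
  "dissipation k = (\<eta>A - (onorm A)\<^sup>2) * (norm (x (Suc k) - x k))\<^sup>2
     + (\<eta>B - (onorm B)\<^sup>2) * (norm (y (Suc k) - y k))\<^sup>2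
     + (norm ((l (Suc k) - l k) /\<^sub>R \<beta> k - B (y (Suc k) - y k)))\<^sup>2"

lemma energy_lower_bound:
  "(\<eta>A - (onorm A)\<^sup>2) * (norm (x k - x'))\<^sup>2 + \<eta>B * (norm (y k - y'))\<^sup>2
     + (norm ((l k - l') /\<^sub>R \<beta> k))\<^sup>2 \<le> energy (x', y', l') k"
  using norm_A_le[of "x k - x'"] by (simp add: energy_def algebra_simps)

text \<open>The factor 1 in the third bound gives it the shape that
  \<open>tendsto_zero_of_scaled_square_le\<close> expects.\<close>

lemma energy_bounds:
  shows "(\<eta>A - (onorm A)\<^sup>2) * (norm (x k - x'))\<^sup>2 \<le> energy (x', y', l') k"
    and "\<eta>B * (norm (y k - y'))\<^sup>2 \<le> energy (x', y', l') k"
    and "1 * (norm ((l k - l') /\<^sub>R \<beta> k))\<^sup>2 \<le> energy (x', y', l') k"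
    and "0 \<le> energy (x', y', l') k"
proof -
  have parts: "0 \<le> (\<eta>A - (onorm A)\<^sup>2) * (norm (x k - x'))\<^sup>2" "0 \<le> \<eta>B * (norm (y k - y'))\<^sup>2"
    "0 \<le> (norm ((l k - l') /\<^sub>R \<beta> k))\<^sup>2"
    using \<eta>A \<eta>B_pos by auto
  then show "(\<eta>A - (onorm A)\<^sup>2) * (norm (x k - x'))\<^sup>2 \<le> energy (x', y', l') k"
    "\<eta>B * (norm (y k - y'))\<^sup>2 \<le> energy (x', y', l') k"
    "1 * (norm ((l k - l') /\<^sub>R \<beta> k))\<^sup>2 \<le> energy (x', y', l') k"
    "0 \<le> energy (x', y', l') k"
    using energy_lower_bound[of k x' y' l'] by linarith+
qed

lemma energy_nonneg: "energy p k \<ge> 0"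
  by (cases p) (simp add: energy_bounds(4))

lemma energy_descent:
  assumes "kkt_point f g A B c p"
  shows "energy p (Suc k) + dissipation k \<le> energy p k"
proof -
  obtain x' y' l' where p: "p = (x', y', l')" by (cases p)
  have feas: "A x' + B y' = c" and kx: "- adjoint A l' \<in> subdifferential f x'"
    and ky: "- adjoint B l' \<in> subdifferential g y'"
    using assms by (auto simp: kkt_point_def p)
  define u where "u k = x k - x'" for k
  define v where "v k = y k - y'" for k
  define q where "q = (l k - l') /\<^sub>R \<beta> k"
  \<comment> \<open>Both multiplier errors are divided by the same \<open>\<beta> k\<close>, so the
    multiplier update becomes the addition of the residual. The energy at \<open>Suc k\<close>
    divides by \<open>\<beta> (Suc k)\<close> instead.\<close>
  define q' where "q' = (l (Suc k) - l') /\<^sub>R \<beta> k"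
  note pos = \<beta>_pos[of k]
  have du: "x (Suc k) - x k = u (Suc k) - u k" and dv: "y (Suc k) - y k = v (Suc k) - v k"
    by (simp_all add: u_def v_def)
  have res: "A (x i) + B (y j) - c = A (u i) + B (v j)" for i j
    using feas by (simp add: u_def v_def A.diff B.diff algebra_simps)
  have l_k: "l k = l' + \<beta> k *\<^sub>R q" using pos by (simp add: q_def)
  have q': "q' = q + (A (u (Suc k)) + B (v (Suc k)))"
    using pos unfolding q'_def l_step res l_k by (simp add: algebra_simps)
  have mx: "0 \<le> - \<eta>A * ((u (Suc k) - u k) \<bullet> u (Suc k))
      - (q' - (A (u (Suc k)) - A (u k)) - (B (v (Suc k)) - B (v k))) \<bullet> A (u (Suc k))"
  proof -
    have "0 \<le> (- (\<beta> k * \<eta>A) *\<^sub>R (u (Suc k) - u k)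
      - adjoint A (l k + \<beta> k *\<^sub>R (A (u k) + B (v k))) + adjoint A l') \<bullet> u (Suc k)"
      using subdifferential_monotone[OF x_step[of k] kx] by (simp add: res du u_def[symmetric])
    also have "\<dots> = \<beta> k * (- \<eta>A * ((u (Suc k) - u k) \<bullet> u (Suc k))
      - (q + (A (u k) + B (v k))) \<bullet> A (u (Suc k)))"
      by (simp add: inner_diff_left inner_add_left inner_adjoint_A l_k algebra_simps)
    also have "q + (A (u k) + B (v k)) = q' - (A (u (Suc k)) - A (u k)) - (B (v (Suc k)) - B (v k))"
      by (simp add: q')
    finally show ?thesis using pos by (simp add: zero_le_mult_iff)
  qed
  have my: "0 \<le> - \<eta>B * ((v (Suc k) - v k) \<bullet> v (Suc k))
      - (q' - (B (v (Suc k)) - B (v k))) \<bullet> B (v (Suc k))"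
  proof -
    have "0 \<le> (- (\<beta> k * \<eta>B) *\<^sub>R (v (Suc k) - v k)
      - adjoint B (l k + \<beta> k *\<^sub>R (A (u (Suc k)) + B (v k))) + adjoint B l') \<bullet> v (Suc k)"
      using subdifferential_monotone[OF y_step[of k] ky] by (simp add: res dv v_def[symmetric])
    also have "\<dots> = \<beta> k * (- \<eta>B * ((v (Suc k) - v k) \<bullet> v (Suc k))
      - (q + (A (u (Suc k)) + B (v k))) \<bullet> B (v (Suc k)))"
      by (simp add: inner_diff_left inner_add_left inner_adjoint_B l_k algebra_simps)
    \<comment> \<open>The y-step already uses the new x, so no increment of \<open>A\<close>
      appears, in contrast to the x-step.\<close>
    also have "q + (A (u (Suc k)) + B (v k)) = q' - (B (v (Suc k)) - B (v k))"
      by (simp add: q')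
    finally show ?thesis using pos by (simp add: zero_le_mult_iff)
  qed
  \<comment> \<open>Here monotonicity of the penalties enters: passing to the divisor
    \<open>\<beta> (Suc k)\<close> can only shrink the multiplier term.\<close>
  have "norm ((l (Suc k) - l') /\<^sub>R \<beta> (Suc k)) \<le> norm q'"
    using pos \<beta>_pos[of "Suc k"] incseqD[OF \<beta>_mono, of k "Suc k"]
    by (auto simp: q'_def intro!: mult_right_mono le_imp_inverse_le)
  then have "(norm ((l (Suc k) - l') /\<^sub>R \<beta> (Suc k)))\<^sup>2 \<le> (norm q')\<^sup>2" by (intro power_mono) auto
  moreover have "energy p k = \<eta>A * (norm (u k))\<^sup>2 - (norm (A (u k)))\<^sup>2 + \<eta>B * (norm (v k))\<^sup>2 + (norm q)\<^sup>2"
    by (simp add: energy_def p u_def v_def q_def)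
  moreover have "energy p (Suc k) = \<eta>A * (norm (u (Suc k)))\<^sup>2 - (norm (A (u (Suc k))))\<^sup>2
      + \<eta>B * (norm (v (Suc k)))\<^sup>2 + (norm ((l (Suc k) - l') /\<^sub>R \<beta> (Suc k)))\<^sup>2"
    by (simp add: energy_def p u_def v_def)
  moreover have "(l (Suc k) - l k) /\<^sub>R \<beta> k = q' - q"
    by (simp add: q_def q'_def algebra_simps)
  then have "dissipation k = (\<eta>A - (onorm A)\<^sup>2) * (norm (u (Suc k) - u k))\<^sup>2
      + (\<eta>B - (onorm B)\<^sup>2) * (norm (v (Suc k) - v k))\<^sup>2
      + (norm ((q' - q) - (B (v (Suc k)) - B (v k))))\<^sup>2"
    by (simp only: dissipation_def du dv B.diff)
  ultimately show ?thesis
    using ladmap_descent_algebra[OF q' mx my] norm_A_le[of "u (Suc k) - u k", unfolded A.diff]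
      norm_B_le[of "v (Suc k) - v k", unfolded B.diff]
    by (simp only: left_diff_distrib)
qed

lemma dissipation_bounds:
  shows "(\<eta>A - (onorm A)\<^sup>2) * (norm (x (Suc k) - x k))\<^sup>2 \<le> dissipation k"
    and "(\<eta>B - (onorm B)\<^sup>2) * (norm (y (Suc k) - y k))\<^sup>2 \<le> dissipation k"
    and "(norm ((l (Suc k) - l k) /\<^sub>R \<beta> k - B (y (Suc k) - y k)))\<^sup>2 \<le> dissipation k"
    and "0 \<le> dissipation k"
proof -
  have "0 \<le> (\<eta>A - (onorm A)\<^sup>2) * (norm (x (Suc k) - x k))\<^sup>2"
    "0 \<le> (\<eta>B - (onorm B)\<^sup>2) * (norm (y (Suc k) - y k))\<^sup>2"
    using \<eta>A \<eta>B by auto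
  then show "(\<eta>A - (onorm A)\<^sup>2) * (norm (x (Suc k) - x k))\<^sup>2 \<le> dissipation k"
    "(\<eta>B - (onorm B)\<^sup>2) * (norm (y (Suc k) - y k))\<^sup>2 \<le> dissipation k"
    "(norm ((l (Suc k) - l k) /\<^sub>R \<beta> k - B (y (Suc k) - y k)))\<^sup>2 \<le> dissipation k"
    "0 \<le> dissipation k"
    by (auto simp: dissipation_def)
qed

lemma energy_decseq: "kkt_point f g A B c p \<Longrightarrow> decseq (energy p)"
  by (intro decseq_SucI order_trans[OF _ energy_descent]) (simp_all add: dissipation_bounds(4))

lemma energy_convergent:
  assumes "kkt_point f g A B c p"
  shows "\<exists>e. energy p \<longlonglongrightarrow> e"
proof -
  have "\<forall>k. 0 \<le> energy p k" using energy_nonneg by simp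
  then show ?thesis
    by (rule decseq_convergent[OF energy_decseq[OF assms]]) (rule exI)
qed

section \<open>Vanishing increments and bounded iterates\<close>

lemma dissipation_tendsto_zero:
  assumes "kkt_point f g A B c p"
  shows "dissipation \<longlonglongrightarrow> 0"
proof -
  obtain e where e: "energy p \<longlonglongrightarrow> e" using energy_convergent[OF assms] ..
  then have "(\<lambda>k. energy p k - energy p (Suc k)) \<longlonglongrightarrow> e - e"
    by (intro tendsto_diff LIMSEQ_Suc)
  then have "(\<lambda>k. energy p k - energy p (Suc k)) \<longlonglongrightarrow> 0" by simp
  \<comment> \<open>The dissipation is at most the drop of a convergent sequence.\<close>
  moreover have le: "norm (dissipation k) \<le> energy p k - energy p (Suc k)" for k
    using dissipation_bounds(4)[of k] energy_descent[OF assms, of k] by simp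
  ultimately show ?thesis
    by (intro Lim_null_comparison[OF always_eventually[OF allI[OF le]]])
qed

lemma differences_tendsto_zero:
  assumes "kkt_point f g A B c p"
  shows "(\<lambda>k. x (Suc k) - x k) \<longlonglongrightarrow> 0" "(\<lambda>k. y (Suc k) - y k) \<longlonglongrightarrow> 0"
    "(\<lambda>k. A (x (Suc k)) + B (y (Suc k)) - c) \<longlonglongrightarrow> 0"
proof -
  note d = dissipation_tendsto_zero[OF assms]
  show "(\<lambda>k. x (Suc k) - x k) \<longlonglongrightarrow> 0"
    using \<eta>A by (intro tendsto_zero_of_scaled_square_le[OF _ dissipation_bounds(1) d]) simp
  show dy: "(\<lambda>k. y (Suc k) - y k) \<longlonglongrightarrow> 0"
    using \<eta>B by (intro tendsto_zero_of_scaled_square_le[OF _ dissipation_bounds(2) d]) simp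
  \<comment> \<open>The scaled multiplier increment is the residual. The dissipation controls it up
    to \<open>B\<close> applied to the y-increment, which is already known to vanish.\<close>
  have "(\<lambda>k. (l (Suc k) - l k) /\<^sub>R \<beta> k - B (y (Suc k) - y k)) \<longlonglongrightarrow> 0"
    by (rule tendsto_zero_of_scaled_square_le[OF zero_less_one _ d])
      (simp only: mult_1 dissipation_bounds(3))
  from tendsto_add[OF this B.tendsto_zero[OF dy]]
  have "(\<lambda>k. (l (Suc k) - l k) /\<^sub>R \<beta> k) \<longlonglongrightarrow> 0" by simp
  moreover have "(l (Suc k) - l k) /\<^sub>R \<beta> k = A (x (Suc k)) + B (y (Suc k)) - c" for k
    using \<beta>_pos[of k] by (simp add: l_step)
  ultimately show "(\<lambda>k. A (x (Suc k)) + B (y (Suc k)) - c) \<longlonglongrightarrow> 0" by simp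
qed

lemma \<beta>_scaleR_tendsto_zero:
  fixes h :: "nat \<Rightarrow> 'a::real_normed_vector"
  assumes "h \<longlonglongrightarrow> 0"
  shows "(\<lambda>k. \<beta> k *\<^sub>R h k) \<longlonglongrightarrow> 0"
proof -
  obtain b where "\<beta> \<longlonglongrightarrow> b" by (rule \<beta>_convergent)
  from tendsto_scaleR[OF this assms] show ?thesis by simp
qed

lemma iterates_bounded:
  assumes "kkt_point f g A B c p"
  shows "\<exists>R. \<forall>k. norm (x k) \<le> R \<and> norm (y k) \<le> R \<and> norm (l k) \<le> R"
proof -
  obtain x' y' l' where p: "p = (x', y', l')" by (cases p)
  have E: "energy p k \<le> energy p 0" for k
    using decseqD[OF energy_decseq[OF assms], of 0 k] by simp
  have sq: "norm h \<le> sqrt (energy p 0 / a)" if "a > 0" "a * (norm h)\<^sup>2 \<le> energy p k" for a k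
    and h :: "'z::real_normed_vector"
    using that E[of k] by (intro real_le_rsqrt) (simp add: field_simps)
  obtain b where b: "\<And>k. \<beta> k \<le> b" using \<beta>_bdd by (auto simp: bdd_above_def)
  have "norm (x k - x') \<le> sqrt (energy p 0 / (\<eta>A - (onorm A)\<^sup>2))" for k
    using \<eta>A energy_bounds(1)[of k x' y' l'] by (intro sq[of _ _ k]) (auto simp: p)
  then have "norm (x k) \<le> norm x' + sqrt (energy p 0 / (\<eta>A - (onorm A)\<^sup>2))" (is "_ \<le> ?Rx") for k
    using norm_triangle_sub[of "x k" x'] by (meson add_left_mono order_trans)
  moreover have "norm (y k - y') \<le> sqrt (energy p 0 / \<eta>B)" for k
    using \<eta>B_pos energy_bounds(2)[of k y' x' l'] by (intro sq[of _ _ k]) (auto simp: p)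
  then have "norm (y k) \<le> norm y' + sqrt (energy p 0 / \<eta>B)" (is "_ \<le> ?Ry") for k
    using norm_triangle_sub[of "y k" y'] by (meson add_left_mono order_trans)
  \<comment> \<open>The energy bounds only the multiplier error divided by \<open>\<beta> k\<close>;
    the upper bound \<open>b\<close> of the penalties removes the divisor.\<close>
  moreover have "norm (l k) \<le> norm l' + b * sqrt (energy p 0 / 1)" (is "_ \<le> ?Rl") for k
  proof -
    have "norm ((l k - l') /\<^sub>R \<beta> k) \<le> sqrt (energy p 0 / 1)"
      by (rule sq[OF zero_less_one, of _ k]) (simp only: p energy_bounds(3))
    then have "\<beta> k * norm ((l k - l') /\<^sub>R \<beta> k) \<le> b * sqrt (energy p 0 / 1)"
      using b[of k] \<beta>_pos[of k] by (intro mult_mono) auto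
    moreover have "\<beta> k * norm ((l k - l') /\<^sub>R \<beta> k) = norm (l k - l')" using \<beta>_pos[of k] by simp
    ultimately show ?thesis using norm_triangle_sub[of "l k" l'] by linarith
  qed
  ultimately have "norm (x k) \<le> max ?Rx (max ?Ry ?Rl) \<and> norm (y k) \<le> max ?Rx (max ?Ry ?Rl)
      \<and> norm (l k) \<le> max ?Rx (max ?Ry ?Rl)" for k
    by (meson le_max_iff_disj)
  then show ?thesis by blast
qed

section \<open>Cluster points\<close>

lemma cluster_point_kkt:
  assumes kkt: "kkt_point f g A B c p" and r: "strict_mono r"
    and lx: "(\<lambda>n. x (r n)) \<longlonglongrightarrow> x'" and ly: "(\<lambda>n. y (r n)) \<longlonglongrightarrow> y'" and ll: "(\<lambda>n. l (r n)) \<longlonglongrightarrow> l'"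
  shows "kkt_point f g A B c (x', y', l')"
proof -
  have sub: "(\<lambda>n. h (r n)) \<longlonglongrightarrow> 0" if "h \<longlonglongrightarrow> 0" for h :: "nat \<Rightarrow> 'z::real_normed_vector"
    using LIMSEQ_subseq_LIMSEQ[OF that r] by (simp add: o_def)
  note d = differences_tendsto_zero[OF kkt]
  \<comment> \<open>The inclusions hold at the indices \<open>Suc (r n)\<close>, outside the
    subsequence; since the increments vanish, the shifted subsequence has the same limit.\<close>
  have lx': "(\<lambda>n. x (Suc (r n))) \<longlonglongrightarrow> x'" using tendsto_add[OF sub[OF d(1)] lx] by simp
  have ly': "(\<lambda>n. y (Suc (r n))) \<longlonglongrightarrow> y'" using tendsto_add[OF sub[OF d(2)] ly] by simp
  have feas: "A x' + B y' - c = 0"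
    by (intro LIMSEQ_unique[OF _ sub[OF d(3)]] tendsto_intros A.tendsto B.tendsto lx' ly')
  obtain b where "\<beta> \<longlonglongrightarrow> b" by (rule \<beta>_convergent)
  then have lb: "(\<lambda>n. \<beta> (r n)) \<longlonglongrightarrow> b"
    using LIMSEQ_subseq_LIMSEQ[OF _ r] by (simp add: o_def)
  have "- adjoint A l' \<in> subdifferential f x'"
  proof (rule subdifferential_closed_limit[OF cont_f lx' x_step])
    fix z
    \<comment> \<open>The limit is left unsimplified to match the limit rules. The terms with
      \<open>b\<close> then disappear, because the increment and the residual of the limit are
      0.\<close>
    have "(\<lambda>n. - (\<beta> (r n) * \<eta>A) * ((x (Suc (r n)) - x (r n)) \<bullet> (z - x (Suc (r n))))
        - (l (r n) + \<beta> (r n) *\<^sub>R (A (x (r n)) + B (y (r n)) - c)) \<bullet> A (z - x (Suc (r n))))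
      \<longlonglongrightarrow> - (b * \<eta>A) * (0 \<bullet> (z - x')) - (l' + b *\<^sub>R (A x' + B y' - c)) \<bullet> A (z - x')"
      by (intro tendsto_intros A.tendsto B.tendsto lx ly ll lx' lb sub[OF d(1)])
    then show "(\<lambda>n. (- (\<beta> (r n) * \<eta>A) *\<^sub>R (x (Suc (r n)) - x (r n))
        - adjoint A (l (r n) + \<beta> (r n) *\<^sub>R (A (x (r n)) + B (y (r n)) - c))) \<bullet> (z - x (Suc (r n))))
      \<longlonglongrightarrow> - adjoint A l' \<bullet> (z - x')"
      by (simp only: inner_diff_left inner_adjoint_A inner_scaleR_left inner_minus_left feas) simp
  qed
  moreover have "- adjoint B l' \<in> subdifferential g y'"
  proof (rule subdifferential_closed_limit[OF cont_g ly' y_step])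
    fix z
    have "(\<lambda>n. - (\<beta> (r n) * \<eta>B) * ((y (Suc (r n)) - y (r n)) \<bullet> (z - y (Suc (r n))))
        - (l (r n) + \<beta> (r n) *\<^sub>R (A (x (Suc (r n))) + B (y (r n)) - c)) \<bullet> B (z - y (Suc (r n))))
      \<longlonglongrightarrow> - (b * \<eta>B) * (0 \<bullet> (z - y')) - (l' + b *\<^sub>R (A x' + B y' - c)) \<bullet> B (z - y')"
      by (intro tendsto_intros A.tendsto B.tendsto ly ll lx' ly' lb sub[OF d(2)])
    then show "(\<lambda>n. (- (\<beta> (r n) * \<eta>B) *\<^sub>R (y (Suc (r n)) - y (r n))
        - adjoint B (l (r n) + \<beta> (r n) *\<^sub>R (A (x (Suc (r n))) + B (y (r n)) - c))) \<bullet> (z - y (Suc (r n))))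
      \<longlonglongrightarrow> - adjoint B l' \<bullet> (z - y')"
      by (simp only: inner_diff_left inner_adjoint_B inner_scaleR_left inner_minus_left feas) simp
  qed
  ultimately show ?thesis using feas by (simp add: kkt_point_def)
qed

lemma converges_to_cluster_point:
  assumes kkt: "kkt_point f g A B c (x', y', l')" and r: "strict_mono r"
    and lx: "(\<lambda>n. x (r n)) \<longlonglongrightarrow> x'" and ly: "(\<lambda>n. y (r n)) \<longlonglongrightarrow> y'" and ll: "(\<lambda>n. l (r n)) \<longlonglongrightarrow> l'"
  shows "(\<lambda>k. (x k, y k, l k)) \<longlonglongrightarrow> (x', y', l')"
proof -
  let ?E = "energy (x', y', l')"
  obtain b where b: "\<beta> \<longlonglongrightarrow> b" by (rule \<beta>_convergent)
  \<comment> \<open>A positive limit of the penalties makes the division in the multiplier term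
    continuous at the limit.\<close>
  have "b \<ge> \<beta> 0" using incseq_le[OF \<beta>_mono b] .
  then have "b \<noteq> 0" using \<beta>_pos[of 0] by simp
  obtain e where e: "?E \<longlonglongrightarrow> e" using energy_convergent[OF kkt] ..
  have "(\<lambda>n. ?E (r n)) \<longlonglongrightarrow> e"
    using LIMSEQ_subseq_LIMSEQ[OF e r] by (simp add: o_def)
  moreover have lb: "(\<lambda>n. \<beta> (r n)) \<longlonglongrightarrow> b"
    using LIMSEQ_subseq_LIMSEQ[OF b r] by (simp add: o_def)
  have "(\<lambda>n. \<eta>A * (norm (x (r n) - x'))\<^sup>2 - (norm (A (x (r n) - x')))\<^sup>2
      + \<eta>B * (norm (y (r n) - y'))\<^sup>2 + (norm ((l (r n) - l') /\<^sub>R \<beta> (r n)))\<^sup>2)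
    \<longlonglongrightarrow> \<eta>A * (norm (x' - x'))\<^sup>2 - (norm (A (x' - x')))\<^sup>2
      + \<eta>B * (norm (y' - y'))\<^sup>2 + (norm ((l' - l') /\<^sub>R b))\<^sup>2"
    using \<open>b \<noteq> 0\<close> by (intro tendsto_intros A.tendsto lx ly ll lb)
  then have "(\<lambda>n. ?E (r n)) \<longlonglongrightarrow> 0" by (simp add: energy_def A.zero)
  ultimately have "e = 0" by (rule LIMSEQ_unique)
  then have E: "?E \<longlonglongrightarrow> 0" using e by simp
  have "(\<lambda>k. x k - x') \<longlonglongrightarrow> 0"
    using \<eta>A by (intro tendsto_zero_of_scaled_square_le[OF _ energy_bounds(1) E]) auto
  moreover have "(\<lambda>k. y k - y') \<longlonglongrightarrow> 0"
    by (rule tendsto_zero_of_scaled_square_le[OF \<eta>B_pos energy_bounds(2) E])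
  moreover have "(\<lambda>k. (l k - l') /\<^sub>R \<beta> k) \<longlonglongrightarrow> 0"
    by (rule tendsto_zero_of_scaled_square_le[OF zero_less_one energy_bounds(3) E])
  \<comment> \<open>Convergence of the penalties undoes the division by
    \<open>\<beta> k\<close>.\<close>
  then have "(\<lambda>k. \<beta> k *\<^sub>R ((l k - l') /\<^sub>R \<beta> k)) \<longlonglongrightarrow> 0" by (rule \<beta>_scaleR_tendsto_zero)
  moreover have "\<beta> k *\<^sub>R ((l k - l') /\<^sub>R \<beta> k) = l k - l'" for k using \<beta>_pos[of k] by simp
  ultimately show ?thesis by (auto intro!: tendsto_Pair intro: LIM_zero_cancel)
qed

end

theorem theorem3:
  fixes f :: "'x::real_inner \<Rightarrow> real"
    and g :: "'y::real_inner \<Rightarrow> real"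
    and A :: "'x \<Rightarrow> 'w::real_inner"
    and B :: "'y \<Rightarrow> 'w"
    and c :: 'w
    and \<beta> :: "nat \<Rightarrow> real"
    and \<eta>A \<eta>B :: real
    and x :: "nat \<Rightarrow> 'x" and y :: "nat \<Rightarrow> 'y" and l :: "nat \<Rightarrow> 'w"
  assumes finite_dim_X: "\<exists>S :: 'x set. finite S \<and> span S = UNIV"
    and finite_dim_Y: "\<exists>S :: 'y set. finite S \<and> span S = UNIV"
    and finite_dim_W: "\<exists>S :: 'w set. finite S \<and> span S = UNIV"
    and convex_f: "convex_on UNIV f"
    and convex_g: "convex_on UNIV g"
    and linear_A: "linear A"
    and linear_B: "linear B"
    and kkt_exists: "\<exists>p. kkt_point f g A B c p"
    and beta_pos: "\<And>k. \<beta> k > 0"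
    and beta_mono: "incseq \<beta>"
    and beta_bounded: "bdd_above (range \<beta>)"
    and eta_A: "\<eta>A > (onorm A)\<^sup>2"
    and eta_B: "\<eta>B > (onorm B)\<^sup>2"
    and iterates: "ladmap_sequence f g A B c \<eta>A \<eta>B \<beta> x y l"
  shows "\<exists>p. kkt_point f g A B c p \<and> (\<lambda>k. (x k, y k, l k)) \<longlonglongrightarrow> p"
proof -
  obtain SX :: "'x set" where SX: "finite SX" "span SX = UNIV" using finite_dim_X by blast
  obtain SY :: "'y set" where SY: "finite SY" "span SY = UNIV" using finite_dim_Y by blast
  obtain SW :: "'w set" where SW: "finite SW" "span SW = UNIV" using finite_dim_W by blast
  obtain p where p: "kkt_point f g A B c p" using kkt_exists by blast
  have A: "bounded_linear A" and B: "bounded_linear B"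
    using bounded_linear_finite_span SX SY linear_A linear_B by blast+
  have pos: "\<beta> k * \<eta>A > 0" "\<beta> k * \<eta>B > 0" for k
    using beta_pos[of k] le_less_trans[OF zero_le_power2 eta_A] le_less_trans[OF zero_le_power2 eta_B]
    by auto
  interpret ladmap f g A B c \<eta>A \<eta>B \<beta> x y l
  proof (rule ladmap.intro)
    fix k
    show "- (\<beta> k * \<eta>A) *\<^sub>R (x (Suc k) - x k) - adjoint A (l k + \<beta> k *\<^sub>R (A (x k) + B (y k) - c))
        \<in> subdifferential f (x (Suc k))"
      using iterates unfolding ladmap_sequence_def
      by (intro arg_min_proximal_subgradient[OF SX convex_f pos(1)]) blast
    show "- (\<beta> k * \<eta>B) *\<^sub>R (y (Suc k) - y k) - adjoint B (l k + \<beta> k *\<^sub>R (A (x (Suc k)) + B (y k) - c))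
        \<in> subdifferential g (y (Suc k))"
      using iterates unfolding ladmap_sequence_def
      by (intro arg_min_proximal_subgradient[OF SY convex_g pos(2)]) blast
    show "l (Suc k) = l k + \<beta> k *\<^sub>R (A (x (Suc k)) + B (y (Suc k)) - c)"
      using iterates unfolding ladmap_sequence_def by blast
  qed (use A B beta_mono beta_bounded eta_A eta_B beta_pos in
      \<open>auto intro!: adjoint_works_finite_span[OF SX linear_A] adjoint_works_finite_span[OF SY linear_B]
        convex_on_UNIV_continuous_finite_span[OF SX convex_f]
        convex_on_UNIV_continuous_finite_span[OF SY convex_g]\<close>)
  obtain R where "\<forall>k. norm (x k) \<le> R \<and> norm (y k) \<le> R \<and> norm (l k) \<le> R"
    using iterates_bounded[OF p] by blast
  \<comment> \<open>The iterates stay in a product of compact balls, which yields a convergent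
    subsequence.\<close>
  then have "\<forall>k. (x k, y k, l k) \<in> cball 0 R \<times> cball 0 R \<times> cball 0 R" by simp
  moreover have "compact (cball (0::'x) R \<times> cball (0::'y) R \<times> cball (0::'w) R)"
    by (intro compact_Times compact_cball_finite_span[OF SX] compact_cball_finite_span[OF SY]
        compact_cball_finite_span[OF SW])
  ultimately obtain q r where r: "strict_mono r" and q: "((\<lambda>k. (x k, y k, l k)) \<circ> r) \<longlonglongrightarrow> q"
    using seq_compactE[OF compact_imp_seq_compact, of _ "\<lambda>k. (x k, y k, l k)"] by blast
  obtain x' y' l' where "q = (x', y', l')" by (cases q)
  with q have "(\<lambda>n. (x (r n), y (r n), l (r n))) \<longlonglongrightarrow> (x', y', l')" by (simp add: o_def)
  then have lim: "(\<lambda>n. x (r n)) \<longlonglongrightarrow> x'" "(\<lambda>n. y (r n)) \<longlonglongrightarrow> y'" "(\<lambda>n. l (r n)) \<longlonglongrightarrow> l'"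
    by (auto dest: tendsto_fst tendsto_snd[THEN tendsto_fst] tendsto_snd[THEN tendsto_snd])
  \<comment> \<open>The given KKT point \<open>p\<close> supplies boundedness and vanishing
    increments and need not be the limit. The energy argument is now repeated relative to the
    cluster point.\<close>
  note kkt = cluster_point_kkt[OF p r lim]
  show ?thesis using kkt converges_to_cluster_point[OF kkt r lim] by blast
qed

end
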